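(* Let $H$ be a finite $3$-uniform hypergraph containing no linear cycle. Then $\rho(H)\le \alpha(H)$. Moreover, $\chi(H)\le 3$.
   Context: A finite $3$-uniform hypergraph $H=(V,E)$ consists of a finite vertex set $V=V(H)$ and a set $E=E(H)$ of $3$-element subsets of $V$ (edges). A linear cycle in $H$ is a set of $k\ge 3$ edges of the form $\{v_i,w_i,v_{i+1}\}$, $i=1,\dots,k$ (indices modulo $k$), where $v_1,\dots,v_k,w_1,\dots,w_k$ are $2k$ distinct vertices. Thus only cyclically consecutive edges intersect, they intersect in exactly one vertex, and these intersection vertices are distinct. A set $S\subseteq V$ is independent if no edge of $H$ is contained in $S$; $\alpha(H)$ is the maximum cardinality of an independent set of $H$. $\rho(H)$ is the minimum number of parts in a partition of $V(H)$ into nonempty parts, each of which is an edge of $H$ or a subset of an edge of $H$; single vertices are always allowed as parts (also vertices lying in no edge). $\chi(H)$ is the minimum number of colors in a coloring of $V(H)$ with no monochromatic edge. *)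

theory Defs
  imports "HOL-Library.Disjoint_Sets"
begin

definition three_uniform_hypergraph :: "'a set \<Rightarrow> 'a set set \<Rightarrow> bool" where
  "three_uniform_hypergraph V E \<longleftrightarrow> finite V \<and> (\<forall>e\<in>E. e \<subseteq> V \<and> card e = 3)"

(* The indices 1, ..., k are shifted to 0, ..., k - 1. *)
definition linear_cycle :: "'a set set \<Rightarrow> bool" where
  "linear_cycle F \<longleftrightarrow>
    (\<exists>(k::nat) (v :: nat \<Rightarrow> 'a) (w :: nat \<Rightarrow> 'a).
      k \<ge> 3 \<and> inj_on v {..<k} \<and> inj_on w {..<k} \<and> v ` {..<k} \<inter> w ` {..<k} = {} \<and>
      F = (\<lambda>i. {v i, w i, v (Suc i mod k)}) ` {..<k})"

definition contains_linear_cycle :: "'a set set \<Rightarrow> bool" where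
  "contains_linear_cycle E \<longleftrightarrow> (\<exists>F. F \<subseteq> E \<and> linear_cycle F)"

definition independent_set :: "'a set \<Rightarrow> 'a set set \<Rightarrow> 'a set \<Rightarrow> bool" where
  "independent_set V E S \<longleftrightarrow> S \<subseteq> V \<and> (\<forall>e\<in>E. \<not> e \<subseteq> S)"

(* For a 3-uniform hypergraph on a finite V, the maximum and the two minima below range over
   nonempty sets and are attained: by the empty independent set, the partition into single
   vertices and a colouring that is injective on V, respectively. *)

definition independence_number :: "'a set \<Rightarrow> 'a set set \<Rightarrow> nat" where
  "independence_number V E = Max {card S | S. independent_set V E S}"

definition edge_partition :: "'a set \<Rightarrow> 'a set set \<Rightarrow> 'a set set \<Rightarrow> bool" where
  "edge_partition V E P \<longleftrightarrow>
    partition_on V P \<and> (\<forall>p\<in>P. (\<exists>e\<in>E. p \<subseteq> e) \<or> (\<exists>x\<in>V. p = {x}))"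

definition edge_partition_number :: "'a set \<Rightarrow> 'a set set \<Rightarrow> nat" where
  "edge_partition_number V E = (LEAST n. \<exists>P. edge_partition V E P \<and> card P = n)"

definition proper_coloring :: "'a set \<Rightarrow> 'a set set \<Rightarrow> nat \<Rightarrow> ('a \<Rightarrow> nat) \<Rightarrow> bool" where
  "proper_coloring V E k c \<longleftrightarrow> c ` V \<subseteq> {..<k} \<and> (\<forall>e\<in>E. \<not> (\<exists>i. \<forall>x\<in>e. c x = i))"

definition chromatic_number :: "'a set \<Rightarrow> 'a set set \<Rightarrow> nat" where
  "chromatic_number V E = (LEAST k. \<exists>c. proper_coloring V E k c)"

end

theory Submission
  imports Defs
begin

text \<open>
  Grow a linear tree from a vertex by repeatedly adding an edge that meets the current vertex set
  in exactly one vertex. If there is no linear cycle, then every edge that meets the vertex set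
  \<open>T\<close> of a maximal such tree has two vertices in a common edge of the tree: otherwise a shortest
  path of the tree between two vertices of the edge would close to a linear cycle.
  Hence a set that is strongly independent in the tree (at most one vertex in each tree edge) can
  be added to any independent set of \<open>V - T\<close>, and a colouring of \<open>T\<close> in which all tree edges are
  rainbow can be added to any proper colouring of \<open>V - T\<close>. For linear trees the largest strongly
  independent set is as large as the smallest partition into parts of edges, and a rainbow
  3-colouring exists, so both claims follow by induction on \<open>V\<close>.
\<close>

section \<open>Linear paths\<close>

definition linear_path :: "'a set set \<Rightarrow> nat \<Rightarrow> (nat \<Rightarrow> 'a) \<Rightarrow> (nat \<Rightarrow> 'a) \<Rightarrow> bool" where
  "linear_path F k v w \<longleftrightarrow> inj_on v {..k} \<and> inj_on w {..<k} \<and> v ` {..k} \<inter> w ` {..<k} = {} \<and>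
     (\<forall>i<k. {v i, w i, v (Suc i)} \<in> F)"

definition linear_path_between :: "'a set set \<Rightarrow> nat \<Rightarrow> 'a \<Rightarrow> 'a \<Rightarrow> bool" where
  "linear_path_between F k x y \<longleftrightarrow> (\<exists>v w. linear_path F k v w \<and> v 0 = x \<and> v k = y)"

text \<open>Pointwise form of the definition, suited to case distinctions on indices when
  \<open>v\<close> and \<open>w\<close> are updated at a single place.\<close>

lemma linear_path_iff:
  "linear_path F k v w \<longleftrightarrow>
     (\<forall>m n. m \<le> k \<longrightarrow> n \<le> k \<longrightarrow> v m = v n \<longrightarrow> m = n) \<and>
     (\<forall>m n. m < k \<longrightarrow> n < k \<longrightarrow> w m = w n \<longrightarrow> m = n) \<and>
     (\<forall>m n. m \<le> k \<longrightarrow> n < k \<longrightarrow> v m \<noteq> w n) \<and>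
     (\<forall>i<k. {v i, w i, v (Suc i)} \<in> F)"
  unfolding linear_path_def inj_on_def disjoint_iff by auto

lemma linear_path_between_refl: "linear_path_between F 0 x x"
  unfolding linear_path_between_def linear_path_def by (intro exI[of _ "\<lambda>_. x"]) auto

lemma linear_path_between_edge:
  assumes "{x, z, y} \<in> F" "x \<noteq> y" "x \<noteq> z" "y \<noteq> z"
  shows "linear_path_between F 1 x y"
  unfolding linear_path_between_def linear_path_def
  by (intro exI[of _ "\<lambda>i. if i = 0 then x else y"] exI[of _ "\<lambda>_. z"])
     (use assms in \<open>auto simp: inj_on_def\<close>)

lemma linear_path_between_mono:
  "linear_path_between F k x y \<Longrightarrow> F \<subseteq> G \<Longrightarrow> linear_path_between G k x y"
  unfolding linear_path_between_def linear_path_def by blast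

lemma linear_path_between_sym:
  assumes "linear_path_between F k x y"
  shows "linear_path_between F k y x"
proof -
  obtain v w where p: "linear_path F k v w" "v 0 = x" "v k = y"
    using assms unfolding linear_path_between_def by blast
  have "linear_path F k (\<lambda>i. v (k - i)) (\<lambda>i. w (k - Suc i))"
    unfolding linear_path_iff
  proof (intro conjI allI impI)
    note p' = p(1)[unfolded linear_path_iff]
    show "m = n" if "m \<le> k" "n \<le> k" "v (k - m) = v (k - n)" for m n
    proof -
      have "k - m = k - n" using p' that(3) by (meson diff_le_self)
      then show ?thesis using that by simp
    qed
    show "m = n" if "m < k" "n < k" "w (k - Suc m) = w (k - Suc n)" for m n
    proof -
      have "k - Suc m < k" "k - Suc n < k" using that by auto
      then have "k - Suc m = k - Suc n" using p' that(3) by blast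
      then show ?thesis using that by simp
    qed
    show "v (k - m) \<noteq> w (k - Suc n)" if "m \<le> k" "n < k" for m n
    proof -
      have "k - m \<le> k" "k - Suc n < k" using that by auto
      then show ?thesis using p' by blast
    qed
    fix i assume "i < k"
    then have "{v (k - Suc i), w (k - Suc i), v (Suc (k - Suc i))} \<in> F"
      using p(1) unfolding linear_path_def by auto
    then show "{v (k - i), w (k - Suc i), v (k - Suc i)} \<in> F"
      using \<open>i < k\<close> by (simp add: Suc_diff_Suc insert_commute)
  qed
  then show ?thesis
    using p unfolding linear_path_between_def
    by (intro exI[of _ "\<lambda>i. v (k - i)"] exI[of _ "\<lambda>i. w (k - Suc i)"]) simp
qed

text \<open>The old path stays inside \<open>T\<close>, so the new vertices \<open>a\<close> and
  \<open>b\<close> cannot repeat a vertex of it. The hypothesis \<open>x \<in> T\<close> covers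
  \<open>k = 0\<close>, where no edge of \<open>F\<close> forces the start into
  \<open>T\<close>.\<close>

lemma linear_path_between_snoc:
  assumes "linear_path_between F k x y" "\<Union>F \<subseteq> T" "x \<in> T" "a \<notin> T" "b \<notin> T" "a \<noteq> b"
  shows "linear_path_between (insert {y, a, b} F) (Suc k) x b"
proof -
  obtain v w where p: "linear_path F k v w" "v 0 = x" "v k = y"
    using assms unfolding linear_path_between_def by blast
  have w: "w i \<in> T" "v (Suc i) \<in> T" if "i < k" for i
  proof -
    have "{v i, w i, v (Suc i)} \<in> F" using that p(1) unfolding linear_path_iff by simp
    then have "{v i, w i, v (Suc i)} \<subseteq> T" using assms(2) by blast
    then show "w i \<in> T" "v (Suc i) \<in> T" by auto
  qed
  have v: "v i \<in> T" if "i \<le> k" for i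
    using that w(2)[of "i - 1"] p(2) assms(3) by (cases i) auto
  have "linear_path (insert {y, a, b} F) (Suc k) (v(Suc k := b)) (w(k := a))"
    unfolding linear_path_iff
  proof (intro conjI allI impI)
    note p' = p(1)[unfolded linear_path_iff]
    show "m = n" if "m \<le> Suc k" "n \<le> Suc k" "(v(Suc k := b)) m = (v(Suc k := b)) n" for m n
      using that p' v assms(5) by (auto simp: le_Suc_eq split: if_splits)
    show "m = n" if "m < Suc k" "n < Suc k" "(w(k := a)) m = (w(k := a)) n" for m n
      using that p' w assms(4) by (auto simp: less_Suc_eq split: if_splits)
    show "(v(Suc k := b)) m \<noteq> (w(k := a)) n" if "m \<le> Suc k" "n < Suc k" for m n
      using that p' v[of m] w[of n] assms(4,5,6) by (auto simp: le_Suc_eq less_Suc_eq)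
    fix i assume "i < Suc k"
    then show "{(v(Suc k := b)) i, (w(k := a)) i, (v(Suc k := b)) (Suc i)} \<in> insert {y, a, b} F"
      using p' p(3) by (auto simp: less_Suc_eq)
  qed
  then show ?thesis
    using p(2) unfolding linear_path_between_def
    by (intro exI[of _ "v(Suc k := b)"] exI[of _ "w(k := a)"]) simp
qed

section \<open>Linear trees and their connectedness\<close>

text \<open>The vertex set is carried along with the edge set because the one-vertex tree has no
  edges from which its vertex could be recovered.\<close>

inductive linear_tree :: "'a set set \<Rightarrow> 'a set \<Rightarrow> 'a set set \<Rightarrow> bool" for E where
  single: "linear_tree E {x} {}"
| grow: "linear_tree E T F \<Longrightarrow> {y, a, b} \<in> E \<Longrightarrow> y \<in> T \<Longrightarrow> a \<notin> T \<Longrightarrow> b \<notin> T \<Longrightarrow> a \<noteq> b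
    \<Longrightarrow> linear_tree E (insert a (insert b T)) (insert {y, a, b} F)"

lemma linear_tree_edges: "linear_tree E T F \<Longrightarrow> F \<subseteq> E \<and> \<Union>F \<subseteq> T"
  by (induction rule: linear_tree.induct) auto

text \<open>The rule \<open>single\<close> admits any start vertex; meeting \<open>V\<close>
  excludes a start outside \<open>V\<close>. In a growth step the vertex \<open>y\<close> lies in an
  edge, hence in \<open>V\<close>, so the condition passes to the smaller tree.\<close>

lemma linear_tree_verts:
  "linear_tree E T F \<Longrightarrow> \<Union>E \<subseteq> V \<Longrightarrow> T \<inter> V \<noteq> {} \<Longrightarrow> T \<subseteq> V"
  by (induction rule: linear_tree.induct) auto

text \<open>A path to the attachment vertex \<open>y\<close> extends by the new edge to either new
  vertex, and the new edge itself joins \<open>a\<close> and \<open>b\<close>.\<close>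

lemma linear_tree_connected:
  assumes "linear_tree E T F" "x \<in> T" "z \<in> T"
  shows "\<exists>k. linear_path_between F k x z"
  using assms
proof (induction arbitrary: x z rule: linear_tree.induct)
  case (single u)
  then show ?case using linear_path_between_refl by force
next
  case (grow T F y a b)
  let ?F = "insert {y, a, b} F"
  have FT: "\<Union>F \<subseteq> T" using linear_tree_edges[OF grow.hyps(1)] by blast
  have new: "\<exists>k. linear_path_between ?F k u c" if uc: "u \<in> T" "c \<in> {a, b}" for u c
  proof -
    obtain k where k: "linear_path_between F k u y" using grow.IH[OF uc(1) grow.hyps(3)] ..
    have "linear_path_between ?F (Suc k) u b"
      by (rule linear_path_between_snoc[OF k FT]) (use uc grow.hyps in auto)
    \<comment> \<open>The same edge with the roles of \<open>a\<close> and \<open>b\<close>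
      exchanged, so that the path ends in \<open>a\<close>.\<close>
    moreover have "linear_path_between (insert {y, b, a} F) (Suc k) u a"
      by (rule linear_path_between_snoc[OF k FT]) (use uc grow.hyps in auto)
    ultimately show ?thesis using uc(2) by (auto simp: insert_commute)
  qed
  have ab: "\<exists>k. linear_path_between ?F k a b"
    by (intro exI, rule linear_path_between_edge[of _ y])
       (use grow.hyps in \<open>auto simp: insert_commute\<close>)
  have old: "\<exists>k. linear_path_between ?F k u t" if "u \<in> T" "t \<in> T" for u t
    using grow.IH[OF that] linear_path_between_mono[of F _ u t ?F] by blast
  show ?case
    using grow.prems new ab old linear_path_between_refl linear_path_between_sym
    by (metis insert_iff)
qed

section \<open>Edges that meet a linear tree\<close>

text \<open>The edge \<open>{v 0, v k, z}\<close> closes the path, with \<open>z\<close> as its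
  private vertex \<open>w k\<close>. The result has \<open>k + 1\<close> edges, hence at least three
  because \<open>k \<ge> 2\<close>.\<close>

lemma linear_path_imp_cycle:
  assumes "linear_path F k v w" "k \<ge> 2" "z \<notin> v ` {..k}" "z \<notin> w ` {..<k}"
    "{v 0, v k, z} \<in> E" "F \<subseteq> E"
  shows "contains_linear_cycle E"
proof -
  let ?C = "(\<lambda>i. {v i, (w(k := z)) i, v (Suc i mod Suc k)}) ` {..<Suc k}"
  have "linear_cycle ?C"
    unfolding linear_cycle_def
  proof (intro exI conjI)
    show "Suc k \<ge> 3" using assms(2) by simp
    show "inj_on v {..<Suc k}"
      using assms(1) unfolding linear_path_def by (simp add: lessThan_Suc_atMost)
    show "inj_on (w(k := z)) {..<Suc k}"
    proof (rule inj_onI)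
      fix m n assume "m \<in> {..<Suc k}" "n \<in> {..<Suc k}" "(w(k := z)) m = (w(k := z)) n"
      then show "m = n"
        using assms(1,4) unfolding linear_path_iff by (auto simp: less_Suc_eq split: if_splits)
    qed
    show "v ` {..<Suc k} \<inter> (w(k := z)) ` {..<Suc k} = {}"
    proof -
      have "v m \<noteq> (w(k := z)) n" if "m \<le> k" "n < Suc k" for m n
        using assms(1,3) that unfolding linear_path_iff by (auto simp: less_Suc_eq)
      then show ?thesis by (force simp: disjoint_iff less_Suc_eq_le)
    qed
  qed (rule refl)
  moreover have "?C \<subseteq> E"
  proof (rule image_subsetI)
    fix i assume "i \<in> {..<Suc k}"
    then consider "i < k" | "i = k" by fastforce
    then show "{v i, (w(k := z)) i, v (Suc i mod Suc k)} \<in> E"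
    proof cases
      case 1
      then show ?thesis using assms(1,6) unfolding linear_path_def by auto
    next
      case 2
      then show ?thesis using assms(5) by (simp add: insert_commute)
    qed
  qed
  ultimately show ?thesis unfolding contains_linear_cycle_def by blast
qed

text \<open>If \<open>z\<close> is some \<open>v i\<close>, an initial segment ends there. If
  \<open>z\<close> is some \<open>w i\<close>, the path can be stopped in edge \<open>i\<close>,
  which costs \<open>i + 1\<close> edges; this is too long only for the last edge, which alone then
  joins \<open>z\<close> to \<open>v k\<close>.\<close>

lemma shorter_linear_path:
  assumes "linear_path F k v w" "z \<in> v ` {..k} \<union> w ` {..<k}" "z \<noteq> v 0" "z \<noteq> v k" "k \<ge> 2"
  shows "\<exists>j<k. linear_path_between F j (v 0) z \<or> linear_path_between F j (v k) z"
proof -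
  note p = assms(1)[unfolded linear_path_iff]
  consider i where "i < k" "z = v i" | i where "i < k" "z = w i"
    using assms(2,4) by (auto simp: le_less)
  then show ?thesis
  proof cases
    case 1
    have "linear_path F i v w"
      using p 1(1) unfolding linear_path_iff by auto
    then show ?thesis using 1 unfolding linear_path_between_def by blast
  next
    case 2
    show ?thesis
    proof (cases "Suc i = k")
      case True
      have "{v k, v i, w i} \<in> F" using p 2(1) True by (metis insert_commute)
      moreover have "v k \<noteq> w i" "v i \<noteq> w i" "v k \<noteq> v i"
        using p 2(1) by (metis order_refl, metis less_imp_le,
          metis less_imp_le less_irrefl order_refl)
      ultimately have "linear_path_between F 1 (v k) z"
        using 2(2) by (intro linear_path_between_edge[of _ "v i"]) auto
      then show ?thesis using assms(5) by (intro exI[of _ 1]) simp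
    next
      case False
      with 2(1) have i: "Suc i < k" by simp
      \<comment> \<open>In edge \<open>i\<close> the private vertex and the exit vertex swap
        roles.\<close>
      have "linear_path F (Suc i) (v(Suc i := w i)) (w(i := v (Suc i)))"
        unfolding linear_path_iff
      proof (intro conjI allI impI)
        have vw: "v m \<noteq> w n" if "m \<le> k" "n < k" for m n using p that by blast
        have vv: "v m = v n \<longleftrightarrow> m = n" if "m \<le> k" "n \<le> k" for m n using p that by blast
        have ww: "w m = w n \<longleftrightarrow> m = n" if "m < k" "n < k" for m n using p that by blast
        show "m = n"
          if "m \<le> Suc i" "n \<le> Suc i" "(v(Suc i := w i)) m = (v(Suc i := w i)) n" for m n
          using that i vv[of m n] vw[of m i] vw[of n i] by (auto split: if_splits)
        show "m = n"
          if "m < Suc i" "n < Suc i" "(w(i := v (Suc i))) m = (w(i := v (Suc i))) n" for m n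
          using that i ww[of m n] vw[of "Suc i" m] vw[of "Suc i" n] by (auto split: if_splits)
        show "(v(Suc i := w i)) m \<noteq> (w(i := v (Suc i))) n" if "m \<le> Suc i" "n < Suc i" for m n
          using that i vw[of m n] vw[of "Suc i" i] vv[of m "Suc i"] ww[of i n] by auto
        fix m assume "m < Suc i"
        moreover have "{v m, w m, v (Suc m)} \<in> F" if "m \<le> i" for m using p i that by simp
        ultimately show "{(v(Suc i := w i)) m, (w(i := v (Suc i))) m, (v(Suc i := w i)) (Suc m)} \<in> F"
          by (cases "m = i") (auto simp: insert_commute)
      qed
      then have "linear_path_between F (Suc i) (v 0) z"
        unfolding linear_path_between_def
        by (intro exI[of _ "v(Suc i := w i)"] exI[of _ "w(i := v (Suc i))"]) (simp add: 2(2))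
      then show ?thesis using i by blast
    qed
  qed
qed

text \<open>A shortest path between two vertices of \<open>e\<close> avoids the third one, by
  minimality. If it had two or more edges, \<open>e\<close> would close it to a linear cycle; so it
  is a single tree edge.\<close>

lemma edge_shares_two_vertices:
  assumes nc: "\<not> contains_linear_cycle E" and T: "linear_tree E T F"
    and e: "e \<in> E" "card e = 3" and xy: "x \<in> e \<inter> T" "y \<in> e \<inter> T" "x \<noteq> y"
  shows "\<exists>f\<in>F. \<exists>p q. p \<noteq> q \<and> {p, q} \<subseteq> e \<inter> f"
proof -
  \<comment> \<open>The minimum runs over all pairs in \<open>e\<close>, not just \<open>x\<close>
    and \<open>y\<close>, since a shortened path may end in the third vertex
    \<open>z\<close>.\<close>
  define Q where "Q k \<longleftrightarrow> (\<exists>p\<in>e. \<exists>q\<in>e. p \<noteq> q \<and> linear_path_between F k p q)" for k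
  have "\<exists>k. Q k"
    using linear_tree_connected[OF T, of x y] xy unfolding Q_def by blast
  then obtain k where k: "Q k" "\<And>j. j < k \<Longrightarrow> \<not> Q j"
    using exists_least_iff[of Q] by blast
  obtain p q where pq: "p \<in> e" "q \<in> e" "p \<noteq> q" "linear_path_between F k p q"
    using k(1) unfolding Q_def by blast
  obtain v w where path: "linear_path F k v w" "v 0 = p" "v k = q"
    using pq(4) unfolding linear_path_between_def by blast
  have "card (e - {p, q}) = 1"
    using pq e(2) by (simp add: card_Diff_subset)
  then obtain z where "e - {p, q} = {z}" by (auto simp: card_1_singleton_iff)
  then have z: "e = {p, q, z}" "z \<noteq> p" "z \<noteq> q" using pq by auto
  have "k \<noteq> 0" using path(2,3) pq(3) by metis
  have "k < 2"
  proof (rule ccontr)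
    assume "\<not> k < 2"
    then have "k \<ge> 2" by simp
    have "z \<notin> v ` {..k} \<union> w ` {..<k}"
    proof
      assume "z \<in> v ` {..k} \<union> w ` {..<k}"
      then have "\<exists>j<k. linear_path_between F j p z \<or> linear_path_between F j q z"
        using shorter_linear_path[OF path(1), of z] path z \<open>k \<ge> 2\<close> by simp
      then obtain j where "j < k" "linear_path_between F j p z \<or> linear_path_between F j q z"
        by blast
      moreover have "z \<in> e" using z(1) by simp
      ultimately show False using k(2)[of j] pq(1,2) z(2,3) unfolding Q_def by metis
    qed
    then show False
      using linear_path_imp_cycle[OF path(1) \<open>k \<ge> 2\<close>, of z E] path z(1) e(1) nc
        linear_tree_edges[OF T] by auto
  qed
  with \<open>k \<noteq> 0\<close> have "k = 1" by simp
  then have "{p, w 0, q} \<in> F"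
    using path unfolding linear_path_def by auto
  then show ?thesis using pq(1-3) by (intro bexI[of _ "{p, w 0, q}"] exI[of _ p] exI[of _ q]) auto
qed

text \<open>Among the trees containing a fixed vertex of \<open>V\<close>, one with the most
  vertices works: an edge meeting it in exactly one vertex would let it grow, and an edge meeting it
  in more is covered by \<open>edge_shares_two_vertices\<close>.\<close>

lemma maximal_linear_tree:
  assumes H: "three_uniform_hypergraph V E" and nc: "\<not> contains_linear_cycle E" and "V \<noteq> {}"
  shows "\<exists>T F. linear_tree E T F \<and> T \<noteq> {} \<and> T \<subseteq> V \<and>
    (\<forall>e\<in>E. e \<inter> T = {} \<or> (\<exists>f\<in>F. \<exists>p q. p \<noteq> q \<and> {p, q} \<subseteq> e \<inter> f))"
proof -
  obtain x where x: "x \<in> V" using assms(3) by blast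
  have fin: "finite V" and EV: "\<Union>E \<subseteq> V" and card3: "\<And>e. e \<in> E \<Longrightarrow> card e = 3"
    using H unfolding three_uniform_hypergraph_def by auto
  define R where "R T \<longleftrightarrow> (\<exists>F. linear_tree E T F) \<and> x \<in> T" for T
  have RV: "T \<subseteq> V" if "R T" for T
    using that linear_tree_verts[OF _ EV, of T] x unfolding R_def by blast
  have "R {x}" unfolding R_def by (auto intro: linear_tree.single)
  moreover have "\<forall>T. R T \<longrightarrow> card T < Suc (card V)"
    using RV card_mono[OF fin] by (simp add: less_Suc_eq_le)
  ultimately obtain T where T: "R T" "\<And>T'. R T' \<Longrightarrow> card T' \<le> card T"
    using ex_has_greatest_nat[of R "{x}" card "Suc (card V)"] by (auto simp: less_imp_le)
  obtain F where F: "linear_tree E T F" using T(1) unfolding R_def by blast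
  have finT: "finite T" using RV[OF T(1)] fin by (rule finite_subset)
  have "e \<inter> T = {} \<or> (\<exists>f\<in>F. \<exists>p q. p \<noteq> q \<and> {p, q} \<subseteq> e \<inter> f)" if "e \<in> E" for e
  proof (cases "\<exists>y. e \<inter> T = {y}")
    case True
    then obtain y where y: "e \<inter> T = {y}" by blast
    have "card (e - {y}) = 2"
      using y card3[OF that] by (subst card_Diff_singleton) auto
    then obtain a b where ab: "e - {y} = {a, b}" "a \<noteq> b" by (auto simp: card_2_iff)
    then have e: "e = {y, a, b}" and nT: "a \<notin> T" "b \<notin> T" using y by auto
    have "linear_tree E (insert a (insert b T)) (insert {y, a, b} F)"
      by (rule linear_tree.grow[OF F]) (use y e ab nT that in auto)
    then have "R (insert a (insert b T))" using T(1) unfolding R_def by blast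
    then have "card (insert a (insert b T)) \<le> card T" by (rule T(2))
    then show ?thesis using finT ab nT by simp
  next
    case False
    show ?thesis
    proof (cases "e \<inter> T = {}")
      case False
      with \<open>\<nexists>y. e \<inter> T = {y}\<close> obtain u t where "u \<in> e \<inter> T" "t \<in> e \<inter> T" "u \<noteq> t" by blast
      then show ?thesis
        using edge_shares_two_vertices[OF nc F that card3[OF that]] by blast
    qed simp
  qed
  then show ?thesis using F T(1) RV[OF T(1)] unfolding R_def by blast
qed

section \<open>Partitions, strongly independent sets and rainbow colourings of linear trees\<close>

lemma partition_on_Un:
  "partition_on A P \<Longrightarrow> partition_on B Q \<Longrightarrow> A \<inter> B = {} \<Longrightarrow> partition_on (A \<union> B) (P \<union> Q)"
  unfolding partition_on_def using disjoint_union by auto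

definition strongly_independent :: "'a set set \<Rightarrow> 'a set \<Rightarrow> bool" where
  "strongly_independent F S \<longleftrightarrow> (\<forall>f\<in>F. \<forall>p\<in>f \<inter> S. \<forall>q\<in>f \<inter> S. p = q)"

text \<open>
  Quantifying over all subsets \<open>U\<close> makes the induction work: the part \<open>U \<inter> e\<close> for the last edge
  \<open>e\<close> is removed, and one of its vertices outside the smaller tree is selected.
\<close>
lemma linear_tree_partition:
  assumes "linear_tree E T F" "finite U" "U \<subseteq> T"
  shows "\<exists>P S. edge_partition U F P \<and> S \<subseteq> U \<and> strongly_independent F S \<and> card P \<le> card S"
  using assms
proof (induction arbitrary: U rule: linear_tree.induct)
  case (single x)
  \<comment> \<open>Singletons instead of the one part \<open>U\<close>, because \<open>U\<close>
    may be empty.\<close>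
  have "edge_partition U {} ((\<lambda>x. {x}) ` U)" for U :: "'a set"
    unfolding edge_partition_def partition_on_def by (auto simp: disjoint_def)
  then show ?case
    using single card_image_le[of U] by (intro exI[of _ "(\<lambda>x. {x}) ` U"] exI[of _ U])
      (auto simp: strongly_independent_def)
next
  case (grow T F y a b)
  let ?e = "{y, a, b}"
  have FT: "\<Union>F \<subseteq> T" using linear_tree_edges[OF grow.hyps(1)] by blast
  show ?case
  proof (cases "U \<subseteq> T")
    case True
    then obtain P S where PS: "edge_partition U F P" "S \<subseteq> U" "strongly_independent F S"
      "card P \<le> card S"
      using grow.IH grow.prems by blast
    have "edge_partition U (insert ?e F) P" using PS(1) unfolding edge_partition_def by blast
    \<comment> \<open>Here \<open>S\<close> lies in \<open>T\<close>, which the new edge meets only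
      in \<open>y\<close>.\<close>
    moreover have "strongly_independent (insert ?e F) S"
      using PS(2,3) True grow.hyps unfolding strongly_independent_def by auto
    ultimately show ?thesis using PS by blast
  next
    case False
    then obtain c where c: "c \<in> U" "c \<in> {a, b}" using grow.prems by blast
    have sub: "U - ?e \<subseteq> T" "finite (U - ?e)" using grow.prems by auto
    then obtain P S where PS: "edge_partition (U - ?e) F P" "S \<subseteq> U - ?e"
      "strongly_independent F S" "card P \<le> card S"
      using grow.IH[OF sub(2,1)] by (elim exE conjE) (rule that)
    have "partition_on ((U \<inter> ?e) \<union> (U - ?e)) (insert (U \<inter> ?e) P)"
      by (subst insert_is_Un, rule partition_on_Un)
         (use PS(1) c in \<open>auto simp: edge_partition_def intro!: partition_on_space\<close>)
    moreover have "(U \<inter> ?e) \<union> (U - ?e) = U" by blast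
    ultimately have "edge_partition U (insert ?e F) (insert (U \<inter> ?e) P)"
      using PS(1) unfolding edge_partition_def by auto
    \<comment> \<open>The vertex \<open>c\<close> is outside \<open>T\<close>, so no edge of
      \<open>F\<close> contains it; and \<open>S\<close> avoids the new edge entirely, as
      \<open>y\<close> was removed from \<open>U\<close> too.\<close>
    moreover have "strongly_independent (insert ?e F) (insert c S)"
      using PS(2,3) c FT grow.hyps unfolding strongly_independent_def by blast
    moreover have "card (insert (U \<inter> ?e) P) \<le> card (insert c S)"
    proof -
      have "finite S" "c \<notin> S" using PS(2) grow.prems(1) c finite_subset by auto
      then show ?thesis using PS(4) card_insert_le_m1[of "card (insert c S)" P "U \<inter> ?e"] by simp
    qed
    ultimately show ?thesis using PS(2) c by blast
  qed
qed

text \<open>Greedy colouring: only \<open>y\<close> is already coloured in a new edge, so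
  \<open>a\<close> and \<open>b\<close> can take the two other colours, which are the successors of
  \<open>c y\<close> modulo 3.\<close>

lemma linear_tree_rainbow:
  assumes "linear_tree E T F"
  shows "\<exists>c. c ` T \<subseteq> {..<3::nat} \<and> (\<forall>f\<in>F. inj_on c f)"
  using assms
proof (induction rule: linear_tree.induct)
  case (single x)
  show ?case by (intro exI[of _ "\<lambda>_. 0"]) auto
next
  case (grow T F y a b)
  then obtain c where c: "c ` T \<subseteq> {..<3::nat}" "\<forall>f\<in>F. inj_on c f" by blast
  define i j where "i = (c y + 1) mod 3" and "j = (c y + 2) mod 3"
  have "c y < 3" using c(1) grow.hyps(3) by auto
  then have "c y = 0 \<or> c y = 1 \<or> c y = 2" by auto
  then have ij: "i < 3" "j < 3" "i \<noteq> j" "c y \<noteq> i" "c y \<noteq> j" unfolding i_def j_def by auto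
  let ?c = "c(a := i, b := j)"
  have "inj_on ?c f" if "f \<in> F" for f
  proof -
    have "f \<subseteq> T" using that linear_tree_edges[OF grow.hyps(1)] by blast
    then have "\<forall>u\<in>f. ?c u = c u" using grow.hyps by auto
    then show ?thesis using c(2) that inj_on_cong[of f ?c c] by simp
  qed
  moreover have "inj_on ?c {y, a, b}"
    using ij grow.hyps by (auto simp: inj_on_def)
  moreover have "?c ` insert a (insert b T) \<subseteq> {..<3}"
    using ij c(1) by auto
  ultimately show ?case by blast
qed

lemma three_uniform_hypergraph_Diff:
  "three_uniform_hypergraph V E \<Longrightarrow> three_uniform_hypergraph (V - T) {e \<in> E. e \<inter> T = {}}"
  unfolding three_uniform_hypergraph_def by auto

lemma contains_linear_cycle_mono:
  "contains_linear_cycle E \<Longrightarrow> E \<subseteq> E' \<Longrightarrow> contains_linear_cycle E'"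
  unfolding contains_linear_cycle_def by blast

section \<open>Induction on the vertex set\<close>

text \<open>Explicit witnesses replace the extremal numbers, so that those for \<open>T\<close> and
  for \<open>V - T\<close> can simply be united. Both claims share one induction because they use
  the same maximal tree.\<close>

lemma exists_partition_independent_coloring:
  assumes "three_uniform_hypergraph V E" "\<not> contains_linear_cycle E"
  shows "(\<exists>P S. edge_partition V E P \<and> independent_set V E S \<and> card P \<le> card S) \<and>
    (\<exists>c. proper_coloring V E 3 c)"
proof -
  have "finite V" using assms(1) unfolding three_uniform_hypergraph_def by blast
  then show ?thesis using assms
  proof (induction V arbitrary: E rule: finite_psubset_induct)
    case (psubset V)
    show ?case
    proof (cases "V = {}")
      case True
      then have "E = {}" using psubset.prems(1) unfolding three_uniform_hypergraph_def by fastforce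
      then show ?thesis using True
        by (auto simp: edge_partition_def independent_set_def proper_coloring_def partition_on_def
            intro!: exI[of _ "{}"])
    next
      case False
      obtain T F where F: "linear_tree E T F" and T: "T \<noteq> {}" "T \<subseteq> V"
        and meet': "\<forall>e\<in>E. e \<inter> T = {} \<or> (\<exists>f\<in>F. \<exists>p q. p \<noteq> q \<and> {p, q} \<subseteq> e \<inter> f)"
        using maximal_linear_tree[OF psubset.prems False] by (elim exE conjE) (rule that)
      note meet = bspec[OF meet']
      have FE: "F \<subseteq> E" and FT: "\<Union>F \<subseteq> T" using linear_tree_edges[OF F] by auto
      \<comment> \<open>The subhypergraph induced on \<open>V - T\<close>.\<close>
      define E' where "E' = {e \<in> E. e \<inter> T = {}}"
      have "V - T \<subset> V" using T by blast
      moreover have "three_uniform_hypergraph (V - T) E'"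
        unfolding E'_def using psubset.prems(1) by (rule three_uniform_hypergraph_Diff)
      moreover have "\<not> contains_linear_cycle E'"
        using psubset.prems(2) contains_linear_cycle_mono[of E' E] unfolding E'_def by blast
      ultimately obtain P S c where IH: "edge_partition (V - T) E' P" "independent_set (V - T) E' S"
        "card P \<le> card S" "proper_coloring (V - T) E' 3 c"
        using psubset.IH by blast
      have finT: "finite T" using T psubset.hyps finite_subset by blast
      obtain P' S' where T': "edge_partition T F P'" "S' \<subseteq> T" "strongly_independent F S'"
        "card P' \<le> card S'"
        using linear_tree_partition[OF F finT order_refl] by blast
      have "edge_partition V E (P' \<union> P)"
      proof -
        have "partition_on (T \<union> (V - T)) (P' \<union> P)"
          by (rule partition_on_Un) (use IH(1) T'(1) in \<open>auto simp: edge_partition_def\<close>)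
        moreover have "T \<union> (V - T) = V" using T by blast
        moreover have "(\<exists>e\<in>E. p \<subseteq> e) \<or> (\<exists>x\<in>V. p = {x})" if "p \<in> P'" for p
          using that T'(1) FE T(2) unfolding edge_partition_def by (meson in_mono)
        moreover have "(\<exists>e\<in>E. p \<subseteq> e) \<or> (\<exists>x\<in>V. p = {x})" if "p \<in> P" for p
        proof -
          have "(\<exists>e\<in>E'. p \<subseteq> e) \<or> (\<exists>x\<in>V - T. p = {x})"
            using that IH(1) unfolding edge_partition_def by simp
          then show ?thesis unfolding E'_def by auto
        qed
        ultimately show ?thesis unfolding edge_partition_def by auto
      qed
      moreover have "independent_set V E (S' \<union> S)"
        unfolding independent_set_def
      proof (intro conjI ballI notI)
        show "S' \<union> S \<subseteq> V" using T T'(2) IH(2) unfolding independent_set_def by blast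
        fix e assume e: "e \<in> E" "e \<subseteq> S' \<union> S"
        from meet[OF e(1)] show False
        proof
          assume "e \<inter> T = {}"
          then show False using e T'(2) IH(2) unfolding independent_set_def E'_def by blast
        next
          assume "\<exists>f\<in>F. \<exists>p q. p \<noteq> q \<and> {p, q} \<subseteq> e \<inter> f"
          then obtain f p q where f: "f \<in> F" "p \<noteq> q" "{p, q} \<subseteq> e \<inter> f" by blast
          \<comment> \<open>Inside \<open>T\<close> only \<open>S'\<close> contributes to the union,
            so \<open>p\<close> and \<open>q\<close> are two vertices of \<open>S'\<close> in one
            tree edge.\<close>
          have "{p, q} \<subseteq> T" "{p, q} \<subseteq> S' \<union> S" using f(1,3) e(2) FT by auto
          moreover have "S \<inter> T = {}" using IH(2) unfolding independent_set_def by blast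
          ultimately have "p \<in> f \<inter> S'" "q \<in> f \<inter> S'" using f(3) by auto
          then show False using T'(3) f(1,2) unfolding strongly_independent_def by simp
        qed
      qed
      moreover have "card (P' \<union> P) \<le> card (S' \<union> S)"
      proof -
        have "S' \<inter> S = {}" using T'(2) IH(2) unfolding independent_set_def by blast
        moreover have "finite S'" using T'(2) finT finite_subset by blast
        moreover have "finite S"
          using IH(2) psubset.hyps finite_subset[of S V] unfolding independent_set_def by blast
        ultimately have "card (S' \<union> S) = card S' + card S" by (simp add: card_Un_disjoint)
        then show ?thesis using card_Un_le[of P' P] T'(4) IH(3) by linarith
      qed
      moreover have "\<exists>c. proper_coloring V E 3 c"
      proof -
        obtain d where d: "d ` T \<subseteq> {..<3::nat}" "\<forall>f\<in>F. inj_on d f"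
          using linear_tree_rainbow[OF F] by blast
        let ?c = "\<lambda>x. if x \<in> T then d x else c x"
        have "proper_coloring V E 3 ?c"
          unfolding proper_coloring_def
        proof (intro conjI ballI notI)
          show "?c ` V \<subseteq> {..<3}" using d(1) IH(4) unfolding proper_coloring_def by auto
          fix e assume e: "e \<in> E" "\<exists>i. \<forall>x\<in>e. ?c x = i"
          then obtain i where i: "\<forall>x\<in>e. ?c x = i" by blast
          from meet[OF e(1)] show False
          proof
            assume em: "e \<inter> T = {}"
            then have "\<forall>x\<in>e. c x = i" using i by (simp add: disjoint_iff)
            then show False using IH(4) e(1) em unfolding proper_coloring_def E'_def by blast
          next
            assume "\<exists>f\<in>F. \<exists>p q. p \<noteq> q \<and> {p, q} \<subseteq> e \<inter> f"
            then obtain f p q where f: "f \<in> F" "p \<noteq> q" "{p, q} \<subseteq> e \<inter> f" by blast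
            then have "p \<in> T" "q \<in> T" using FT by auto
            \<comment> \<open>On \<open>T\<close> the combined colouring is \<open>d\<close>, which
              is injective on the tree edge \<open>f\<close> containing both \<open>p\<close> and
              \<open>q\<close>.\<close>
            then have "d p = i" "d q = i" using i f(3) by force+
            then show False using d(2) f unfolding inj_on_def by blast
          qed
        qed
        then show ?thesis by blast
      qed
      ultimately show ?thesis by blast
    qed
  qed
qed

theorem theorem1p2:
  fixes V :: "'a set" and E :: "'a set set"
  assumes "three_uniform_hypergraph V E"
    and "\<not> contains_linear_cycle E"
  shows "edge_partition_number V E \<le> independence_number V E \<and> chromatic_number V E \<le> 3"
proof -
  obtain P S c where PS: "edge_partition V E P" "independent_set V E S" "card P \<le> card S"
    and c: "proper_coloring V E 3 c"
    using exists_partition_independent_coloring[OF assms] by blast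
  have "finite V" using assms(1) unfolding three_uniform_hypergraph_def by blast
  \<comment> \<open>Finiteness makes \<open>Max\<close> an upper bound for
    \<open>card S\<close>.\<close>
  then have "finite {S. independent_set V E S}"
    by (rule finite_subset[rotated, OF finite_Pow_iff[THEN iffD2]])
       (auto simp: independent_set_def)
  then have "card S \<le> independence_number V E"
    unfolding independence_number_def using PS(2) by (intro Max_ge) auto
  moreover have "edge_partition_number V E \<le> card P"
    unfolding edge_partition_number_def using PS(1) by (intro Least_le) blast
  moreover have "chromatic_number V E \<le> 3"
    unfolding chromatic_number_def using c by (intro Least_le) blast
  ultimately show ?thesis using PS(3) by linarith
qed

end
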